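(* Let $M_R,M_T\ge1$ be integers and $\rho_1,\rho_2$ real with $|\rho_1|<1$, $|\rho_2|<1$. Let $z_0$, $z_{i1}$ ($2\le i\le M_R$), $z_{1j}$ ($2\le j\le M_T$), $z_{ij}$ ($2\le i\le M_R$, $2\le j\le M_T$) be independent circularly symmetric complex Gaussian random variables with mean $0$ and variance $1$ (i.e. $\mathbb{E}|z|^2=1$), and for $2\le i\le M_R$, $2\le j\le M_T$ put $$h_{11}=z_0,\quad h_{i1}=\sqrt{1-\rho_1^2}\,z_{i1}+\rho_1z_0,\quad h_{1j}=\sqrt{1-\rho_2^2}\,z_{1j}+\rho_2z_0,\quad h_{ij}=\sqrt{1-\rho_1^2\rho_2^2}\,z_{ij}+\rho_1\rho_2z_0 .$$ Let $|h_{\rm FAS}|=\max_{1\le i\le M_R,\,1\le j\le M_T}|h_{ij}|$ and, for $\gamma_{th}>0$, $P_{\rm out}(\gamma_{th})=\Pr(|h_{\rm FAS}|^2<\gamma_{th})$. Then the diversity order satisfies $$d_{\rm Dual}:=-\lim_{\frac{1}{\gamma_{th}}\to\infty}\frac{\log P_{\rm out}(\gamma_{th})}{\log\frac{1}{\gamma_{th}}}=M_RM_T .$$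
   Context: The limit $1/\gamma_{th}\to\infty$ means $\gamma_{th}\to0^+$. *)

theory Defs
  imports "HOL-Probability.Probability"
begin

text \<open>
  Law CN(0, v): the real and imaginary parts are independent and each is normal
  with mean 0 and variance v/2. Note that \<open>normal_density\<close> takes the standard deviation.
  The two lemmas below confirm that the mean is 0 and that E|Z|^2 = v.
\<close>

definition circ_sym_gaussian :: "'a measure \<Rightarrow> real \<Rightarrow> ('a \<Rightarrow> complex) \<Rightarrow> bool" where
  "circ_sym_gaussian M v Z \<longleftrightarrow>
     prob_space.indep_var M borel (\<lambda>\<omega>. Re (Z \<omega>)) borel (\<lambda>\<omega>. Im (Z \<omega>)) \<and>
     distributed M lborel (\<lambda>\<omega>. Re (Z \<omega>)) (normal_density 0 (sqrt (v / 2))) \<and>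
     distributed M lborel (\<lambda>\<omega>. Im (Z \<omega>)) (normal_density 0 (sqrt (v / 2)))"

context prob_space
begin

lemma centered_normal_moments:
  assumes "distributed M lborel X (normal_density 0 \<sigma>)" "\<sigma> > 0"
  shows "integrable M X" "integrable M (\<lambda>\<omega>. (X \<omega>)\<^sup>2)"
    and "expectation X = 0" "expectation (\<lambda>\<omega>. (X \<omega>)\<^sup>2) = \<sigma>\<^sup>2"
proof -
  have nn: "\<And>x. x \<in> space lborel \<Longrightarrow> 0 \<le> normal_density 0 \<sigma> x"
    by simp
  show "integrable M X"
    using distributed_integrable[OF assms(1) _ nn, of "\<lambda>x. x"]
      integrable_normal_moment[OF assms(2), of 0 1] by simp
  show "integrable M (\<lambda>\<omega>. (X \<omega>)\<^sup>2)"
    using distributed_integrable[OF assms(1) _ nn, of "\<lambda>x. x\<^sup>2"]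
      integrable_normal_moment[OF assms(2), of 0 2] by simp
  show m: "expectation X = 0"
    using normal_distributed_expectation[OF assms(2,1)] by simp
  show "expectation (\<lambda>\<omega>. (X \<omega>)\<^sup>2) = \<sigma>\<^sup>2"
    using normal_distributed_variance[OF assms(2,1)] m by simp
qed

lemma circ_sym_gaussian_mean:
  assumes "circ_sym_gaussian M v Z" "v > 0"
  shows "(\<integral>\<omega>. Z \<omega> \<partial>M) = 0"
proof -
  have s: "sqrt (v / 2) > 0" using assms(2) by simp
  note Re = centered_normal_moments[OF _ s, of "\<lambda>\<omega>. Re (Z \<omega>)"]
  note Im = centered_normal_moments[OF _ s, of "\<lambda>\<omega>. Im (Z \<omega>)"]
  have "integrable M (\<lambda>\<omega>. complex_of_real (Re (Z \<omega>)) + \<i> * complex_of_real (Im (Z \<omega>)))"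
    using assms(1) Re(1) Im(1) unfolding circ_sym_gaussian_def
    by (intro Bochner_Integration.integrable_add integrable_mult_right integrable_of_real) auto
  then have "integrable M Z"
    by (simp add: complex_eq[symmetric])
  then show ?thesis
    using assms(1) Re(3) Im(3) unfolding circ_sym_gaussian_def
    by (intro complex_eqI) (simp_all flip: integral_Re integral_Im)
qed

lemma circ_sym_gaussian_variance:
  assumes "circ_sym_gaussian M v Z" "v > 0"
  shows "expectation (\<lambda>\<omega>. (cmod (Z \<omega>))\<^sup>2) = v"
proof -
  have s: "sqrt (v / 2) > 0" using assms(2) by simp
  show ?thesis
    using assms centered_normal_moments[OF _ s, of "\<lambda>\<omega>. Re (Z \<omega>)"]
      centered_normal_moments[OF _ s, of "\<lambda>\<omega>. Im (Z \<omega>)"]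
    unfolding circ_sym_gaussian_def cmod_power2 by simp
qed

end

text \<open>
  The variable \<open>z\<^sub>0\<close> occupies the index \<open>(1, 1)\<close> of the family \<open>z\<close>, so that the whole
  family is indexed by the ports \<open>{1..M\<^sub>R} \<times> {1..M\<^sub>T}\<close>.
\<close>

definition dual_fas_channel ::
  "real \<Rightarrow> real \<Rightarrow> (nat \<times> nat \<Rightarrow> 'a \<Rightarrow> complex) \<Rightarrow> nat \<times> nat \<Rightarrow> 'a \<Rightarrow> complex" where
  "dual_fas_channel \<rho>1 \<rho>2 z = (\<lambda>(i, j) \<omega>.
     let z0 = z (1, 1) \<omega> in
     if i = 1 \<and> j = 1 then z0
     else if j = 1 then complex_of_real (sqrt (1 - \<rho>1\<^sup>2)) * z (i, 1) \<omega> + complex_of_real \<rho>1 * z0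
     else if i = 1 then complex_of_real (sqrt (1 - \<rho>2\<^sup>2)) * z (1, j) \<omega> + complex_of_real \<rho>2 * z0
     else complex_of_real (sqrt (1 - \<rho>1\<^sup>2 * \<rho>2\<^sup>2)) * z (i, j) \<omega> + complex_of_real (\<rho>1 * \<rho>2) * z0)"

definition fas_gain :: "nat \<Rightarrow> nat \<Rightarrow> (nat \<times> nat \<Rightarrow> 'a \<Rightarrow> complex) \<Rightarrow> 'a \<Rightarrow> real" where
  "fas_gain M\<^sub>R M\<^sub>T h \<omega> = Max ((\<lambda>p. cmod (h p \<omega>)) ` ({1..M\<^sub>R} \<times> {1..M\<^sub>T}))"

definition outage_prob :: "'a measure \<Rightarrow> ('a \<Rightarrow> real) \<Rightarrow> real \<Rightarrow> real" where
  "outage_prob M g \<gamma> = measure M {\<omega> \<in> space M. (g \<omega>)\<^sup>2 < \<gamma>}"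

text \<open>
  The limit \<open>1 / \<gamma> \<rightarrow> \<infinity>\<close> is \<open>\<gamma> \<rightarrow> 0\<close> from the right. The relational form includes the
  existence of the limit, which a definition via \<open>Lim\<close> would not.
\<close>

definition has_diversity_order :: "(real \<Rightarrow> real) \<Rightarrow> real \<Rightarrow> bool" where
  "has_diversity_order P d \<longleftrightarrow>
     (\<exists>L. ((\<lambda>\<gamma>. ln (P \<gamma>) / ln (1 / \<gamma>)) \<longlongrightarrow> L) (at_right 0) \<and> d = - L)"

end

theory Submission
  imports Defs "HOL-Real_Asymp.Real_Asymp"
begin

text \<open>
  Every port is \<open>h p = a p * z p + b p * z\<^sub>0\<close> with \<open>0 < a p \<le> 1\<close> and \<open>\<bar>b p\<bar> \<le> 1\<close>. Since
  \<open>z\<^sub>0\<close> is itself a port, the event that all \<open>\<bar>h p\<bar>\<close> are below \<open>r\<close> forces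
  \<open>\<bar>z p\<bar> < 2 r / a p\<close> for every \<open>p\<close>; conversely it is implied by \<open>\<bar>z p\<bar> < r / 2\<close> for every
  \<open>p\<close>. By independence the outage probability thus lies between two constant multiples of
  \<open>(r\<^sup>2) ^ (M\<^sub>R * M\<^sub>T)\<close>, because the probability that a complex Gaussian falls into a disc of
  radius \<open>s\<close> around \<open>0\<close> is of exact order \<open>s\<^sup>2\<close>. No conditioning on \<open>z\<^sub>0\<close> is needed.
\<close>

text \<open>The probability is the integral of the density over an interval of length
  \<open>2 * s\<close>. The bound on \<open>f\<close> is asked for on that interval only, since a
  normal density has no positive lower bound on the whole line.\<close>

lemma (in prob_space) distributed_prob_interval_bounds:
  fixes X :: "'a \<Rightarrow> real" and f :: "real \<Rightarrow> real"
  assumes X: "distributed M lborel X (\<lambda>x. ennreal (f x))" and "0 \<le> s"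
  shows "0 \<le> C \<Longrightarrow> (\<And>x. \<bar>x\<bar> < s \<Longrightarrow> f x \<le> C) \<Longrightarrow> prob {\<omega> \<in> space M. \<bar>X \<omega>\<bar> < s} \<le> C * (2 * s)"
    and "0 \<le> c \<Longrightarrow> (\<And>x. \<bar>x\<bar> < s \<Longrightarrow> c \<le> f x) \<Longrightarrow> c * (2 * s) \<le> prob {\<omega> \<in> space M. \<bar>X \<omega>\<bar> < s}"
proof -
  have "{\<omega> \<in> space M. \<bar>X \<omega>\<bar> < s} = X -` {-s<..<s} \<inter> space M"
    by auto
  then have P: "ennreal (prob {\<omega> \<in> space M. \<bar>X \<omega>\<bar> < s})
      = (\<integral>\<^sup>+x. ennreal (f x) * indicator {-s<..<s} x \<partial>lborel)"
    using distributed_emeasure[OF X, of "{-s<..<s}"] by (simp add: emeasure_eq_measure)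
  have const: "(\<integral>\<^sup>+x. ennreal k * indicator {-s<..<s} x \<partial>lborel) = ennreal (k * (2 * s))"
    if "0 \<le> k" for k
    using that assms(2) by (simp add: nn_integral_cmult ennreal_mult)
  show "prob {\<omega> \<in> space M. \<bar>X \<omega>\<bar> < s} \<le> C * (2 * s)"
    if "0 \<le> C" "\<And>x. \<bar>x\<bar> < s \<Longrightarrow> f x \<le> C"
  proof -
    have "ennreal (prob {\<omega> \<in> space M. \<bar>X \<omega>\<bar> < s}) \<le> ennreal (C * (2 * s))"
      unfolding P const[OF that(1), symmetric]
      by (intro nn_integral_mono) (auto split: split_indicator intro!: ennreal_leI that(2))
    then show ?thesis
      using that(1) assms(2) by simp
  qed
  show "c * (2 * s) \<le> prob {\<omega> \<in> space M. \<bar>X \<omega>\<bar> < s}"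
    if "0 \<le> c" "\<And>x. \<bar>x\<bar> < s \<Longrightarrow> c \<le> f x"
  proof -
    have "ennreal (c * (2 * s)) \<le> ennreal (prob {\<omega> \<in> space M. \<bar>X \<omega>\<bar> < s})"
      unfolding P const[OF that(1), symmetric]
      by (intro nn_integral_mono) (auto split: split_indicator intro!: ennreal_leI that(2))
    then show ?thesis
      by simp
  qed
qed

section \<open>Small discs under a complex Gaussian law\<close>

lemma (in prob_space) circ_sym_gaussian_borel_measurable:
  assumes "circ_sym_gaussian M v Z"
  shows "Z \<in> borel_measurable M"
proof -
  have [measurable]: "(\<lambda>\<omega>. Re (Z \<omega>)) \<in> borel_measurable M" "(\<lambda>\<omega>. Im (Z \<omega>)) \<in> borel_measurable M"
    using assms distributed_measurable unfolding circ_sym_gaussian_def by fastforce+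
  have "(\<lambda>\<omega>. complex_of_real (Re (Z \<omega>)) + \<i> * complex_of_real (Im (Z \<omega>))) \<in> borel_measurable M"
    by measurable
  then show ?thesis
    by (simp add: complex_eq[symmetric])
qed

text \<open>Independence of real and imaginary parts factorises squares but not discs, so the disc
  estimates compare the disc with a circumscribed and an inscribed square.\<close>

lemma (in prob_space) circ_sym_gaussian_prob_square:
  assumes Z: "circ_sym_gaussian M v Z"
  shows "prob {\<omega> \<in> space M. \<bar>Re (Z \<omega>)\<bar> < s \<and> \<bar>Im (Z \<omega>)\<bar> < s}
    = prob {\<omega> \<in> space M. \<bar>Re (Z \<omega>)\<bar> < s} * prob {\<omega> \<in> space M. \<bar>Im (Z \<omega>)\<bar> < s}"
proof -
  have *: "prob ((\<lambda>\<omega>. (Re (Z \<omega>), Im (Z \<omega>))) -` ({-s<..<s} \<times> {-s<..<s}) \<inter> space M)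
    = prob ((\<lambda>\<omega>. Re (Z \<omega>)) -` {-s<..<s} \<inter> space M) * prob ((\<lambda>\<omega>. Im (Z \<omega>)) -` {-s<..<s} \<inter> space M)"
    using Z by (intro indep_varD) (auto simp: circ_sym_gaussian_def)
  have "(\<lambda>\<omega>. Re (Z \<omega>)) -` {-s<..<s} \<inter> space M = {\<omega> \<in> space M. \<bar>Re (Z \<omega>)\<bar> < s}"
    "(\<lambda>\<omega>. Im (Z \<omega>)) -` {-s<..<s} \<inter> space M = {\<omega> \<in> space M. \<bar>Im (Z \<omega>)\<bar> < s}"
    "(\<lambda>\<omega>. (Re (Z \<omega>), Im (Z \<omega>))) -` ({-s<..<s} \<times> {-s<..<s}) \<inter> space M
      = {\<omega> \<in> space M. \<bar>Re (Z \<omega>)\<bar> < s \<and> \<bar>Im (Z \<omega>)\<bar> < s}"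
    by auto
  with * show ?thesis
    by simp
qed

lemma normal_density_sqrt_half: "normal_density 0 (sqrt (1 / 2)) x = exp (- x\<^sup>2) / sqrt pi"
  by (simp add: normal_density_def)

text \<open>The disc lies in the square with sides \<open>2 * s\<close>, and each coordinate density
  is at most 1.\<close>

lemma (in prob_space) circ_sym_gaussian_prob_disc_le:
  assumes Z: "circ_sym_gaussian M 1 Z" and "0 \<le> s"
  shows "prob {\<omega> \<in> space M. cmod (Z \<omega>) < s} \<le> 4 * s\<^sup>2"
proof -
  note [measurable] = circ_sym_gaussian_borel_measurable[OF Z]
  have dens: "normal_density 0 (sqrt (1 / 2)) x \<le> 1" for x
  proof -
    have "exp (- x\<^sup>2) \<le> 1"
      by simp
    also have "1 \<le> sqrt pi"
      using pi_ge_two by simp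
    finally show ?thesis
      unfolding normal_density_sqrt_half by (simp add: divide_le_eq)
  qed
  have "prob {\<omega> \<in> space M. cmod (Z \<omega>) < s}
      \<le> prob {\<omega> \<in> space M. \<bar>Re (Z \<omega>)\<bar> < s \<and> \<bar>Im (Z \<omega>)\<bar> < s}"
    by (intro finite_measure_mono)
      (auto intro: le_less_trans[OF abs_Re_le_cmod] le_less_trans[OF abs_Im_le_cmod])
  also have "\<dots> \<le> (1 * (2 * s)) * (1 * (2 * s))"
    unfolding circ_sym_gaussian_prob_square[OF Z]
    using Z assms(2) dens unfolding circ_sym_gaussian_def
    by (intro mult_mono distributed_prob_interval_bounds(1)) auto
  finally show ?thesis
    by (simp add: power2_eq_square)
qed

text \<open>The square with sides \<open>s\<close> lies in the disc because the modulus is at most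
  the sum of the absolute values of the two parts. The constant \<open>exp (- 1) / sqrt pi\<close>
  is the coordinate density at 1, a lower bound on the square as long as
  \<open>s \<le> 1\<close>.\<close>

lemma (in prob_space) circ_sym_gaussian_prob_disc_ge:
  assumes Z: "circ_sym_gaussian M 1 Z" and s: "0 \<le> s" "s \<le> 1"
  shows "(exp (- 1) / sqrt pi)\<^sup>2 * s\<^sup>2 \<le> prob {\<omega> \<in> space M. cmod (Z \<omega>) < s}"
proof -
  note [measurable] = circ_sym_gaussian_borel_measurable[OF Z]
  define c where "c = exp (- 1) / sqrt pi"
  have c: "0 \<le> c"
    by (simp add: c_def)
  have dens: "c \<le> normal_density 0 (sqrt (1 / 2)) x" if "\<bar>x\<bar> < s / 2" for x
  proof -
    have "x\<^sup>2 \<le> 1"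
      using that s by (simp add: abs_square_le_1)
    then show ?thesis
      unfolding normal_density_sqrt_half c_def by (simp add: divide_right_mono)
  qed
  have "c\<^sup>2 * s\<^sup>2 = (c * (2 * (s / 2))) * (c * (2 * (s / 2)))"
    by (simp add: power2_eq_square)
  also have "\<dots> \<le> prob {\<omega> \<in> space M. \<bar>Re (Z \<omega>)\<bar> < s / 2 \<and> \<bar>Im (Z \<omega>)\<bar> < s / 2}"
    unfolding circ_sym_gaussian_prob_square[OF Z]
    using Z s c dens unfolding circ_sym_gaussian_def
    by (intro mult_mono distributed_prob_interval_bounds(2)) auto
  also have "\<dots> \<le> prob {\<omega> \<in> space M. cmod (Z \<omega>) < s}"
  proof (intro finite_measure_mono subsetI, goal_cases)
    case (1 \<omega>)
    then show ?case
      using cmod_le[of "Z \<omega>"] by auto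
  qed measurable
  finally show ?thesis
    by (simp add: c_def)
qed

section \<open>Independent discs, channel structure and the outage event\<close>

lemma (in prob_space) indep_vars_prob_discs:
  fixes z :: "'i \<Rightarrow> 'a \<Rightarrow> complex"
  assumes "indep_vars (\<lambda>_. borel) z I" "finite I" "I \<noteq> {}"
  shows "prob {\<omega> \<in> space M. \<forall>p\<in>I. cmod (z p \<omega>) < s p}
    = (\<Prod>p\<in>I. prob {\<omega> \<in> space M. cmod (z p \<omega>) < s p})"
proof -
  have "prob (\<Inter>p\<in>I. z p -` ball 0 (s p) \<inter> space M)
      = (\<Prod>p\<in>I. prob (z p -` ball 0 (s p) \<inter> space M))"
    using assms by (intro indep_varsD[OF assms(1)]) auto
  \<comment> \<open>For empty \<open>I\<close> the left side would be \<open>UNIV\<close> instead of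
    \<open>space M\<close>.\<close>
  moreover have "(\<Inter>p\<in>I. z p -` ball 0 (s p) \<inter> space M)
      = {\<omega> \<in> space M. \<forall>p\<in>I. cmod (z p \<omega>) < s p}"
    using assms(3) by auto
  moreover have "z p -` ball 0 (s p) \<inter> space M = {\<omega> \<in> space M. cmod (z p \<omega>) < s p}" for p
    by auto
  ultimately show ?thesis
    by simp
qed

text \<open>Merges the four cases of the channel so that all ports can be treated alike; the port
  \<open>(1, 1)\<close> gets the coefficients 1 and 0. The strict bounds on the correlations keep
  \<open>a p\<close> positive, so that \<open>z p\<close> can be recovered from \<open>h p\<close>
  and \<open>z (1, 1)\<close>.\<close>

lemma dual_fas_channel_decomp:
  fixes z :: "nat \<times> nat \<Rightarrow> 'a \<Rightarrow> complex"
  assumes "\<bar>\<rho>1\<bar> < 1" "\<bar>\<rho>2\<bar> < 1"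
  obtains a b :: "nat \<times> nat \<Rightarrow> real"
  where "\<And>p. 0 < a p" "\<And>p. a p \<le> 1" "\<And>p. \<bar>b p\<bar> \<le> 1"
    and "\<And>p \<omega>. dual_fas_channel \<rho>1 \<rho>2 z p \<omega> = a p * z p \<omega> + b p * z (1, 1) \<omega>"
    and "dual_fas_channel \<rho>1 \<rho>2 z (1, 1) = z (1, 1)"
proof
  define a where "a = (\<lambda>(i :: nat, j :: nat). if i = 1 \<and> j = 1 then 1
    else if j = 1 then sqrt (1 - \<rho>1\<^sup>2) else if i = 1 then sqrt (1 - \<rho>2\<^sup>2)
    else sqrt (1 - \<rho>1\<^sup>2 * \<rho>2\<^sup>2))"
  define b where "b = (\<lambda>(i :: nat, j :: nat). if i = 1 \<and> j = 1 then 0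
    else if j = 1 then \<rho>1 else if i = 1 then \<rho>2 else \<rho>1 * \<rho>2)"
  have sq: "\<rho>1\<^sup>2 < 1" "\<rho>2\<^sup>2 < 1"
    using assms by (simp_all add: abs_square_less_1)
  have "\<bar>\<rho>1 * \<rho>2\<bar> < 1"
    using assms mult_strict_mono'[of "\<bar>\<rho>1\<bar>" 1 "\<bar>\<rho>2\<bar>" 1] by (simp add: abs_mult)
  then have prd: "\<bar>\<rho>1 * \<rho>2\<bar> < 1" "\<rho>1\<^sup>2 * \<rho>2\<^sup>2 < 1"
    using abs_square_less_1[of "\<rho>1 * \<rho>2"] by (simp_all add: power_mult_distrib)
  show "0 < a p" "a p \<le> 1" for p
    using sq prd by (auto simp: a_def split: prod.split)
  show "\<bar>b p\<bar> \<le> 1" for p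
    using assms prd by (auto simp: b_def split: prod.split)
  show "dual_fas_channel \<rho>1 \<rho>2 z p \<omega> = a p * z p \<omega> + b p * z (1, 1) \<omega>"
    for p \<omega>
    by (auto simp: dual_fas_channel_def a_def b_def Let_def split: prod.split)
  show "dual_fas_channel \<rho>1 \<rho>2 z (1, 1) = z (1, 1)"
    by (auto simp: dual_fas_channel_def Let_def)
qed

text \<open>The maximum is nonnegative, so its square can be compared with \<gamma> by taking roots.
  The outage event becomes a conjunction over the ports.\<close>

lemma fas_gain_power2_less_iff:
  assumes "M\<^sub>R \<ge> 1" "M\<^sub>T \<ge> 1" "0 < \<gamma>"
  shows "(fas_gain M\<^sub>R M\<^sub>T h \<omega>)\<^sup>2 < \<gamma> \<longleftrightarrow> (\<forall>p\<in>{1..M\<^sub>R} \<times> {1..M\<^sub>T}. cmod (h p \<omega>) < sqrt \<gamma>)"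
proof -
  let ?S = "(\<lambda>p. cmod (h p \<omega>)) ` ({1..M\<^sub>R} \<times> {1..M\<^sub>T})"
  have S: "finite ?S" "?S \<noteq> {}"
    using assms by auto
  then have "0 \<le> Max ?S"
    by (subst Max_ge_iff) auto
  then have "(Max ?S)\<^sup>2 < \<gamma> \<longleftrightarrow> Max ?S < sqrt \<gamma>"
    using assms(3) real_less_rsqrt real_sqrt_less_iff[of "(Max ?S)\<^sup>2" \<gamma>] by auto
  then show ?thesis
    unfolding fas_gain_def using S by simp
qed

section \<open>Passage to the logarithmic scale\<close>

text \<open>Constant factors disappear after division by \<open>ln (1 / \<gamma>)\<close>, which
  tends to infinity, while \<open>n * ln \<gamma>\<close> contributes exactly \<open>- n\<close>.
  Both bounds therefore have the same limit.\<close>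

lemma has_diversity_orderI:
  assumes "0 < c" "0 < C"
    and lower: "eventually (\<lambda>\<gamma>. c * \<gamma> ^ n \<le> P \<gamma>) (at_right 0)"
    and upper: "eventually (\<lambda>\<gamma>. P \<gamma> \<le> C * \<gamma> ^ n) (at_right 0)"
  shows "has_diversity_order P (real n)"
proof -
  have lim: "((\<lambda>\<gamma>. (ln k + real n * ln \<gamma>) / ln (1 / \<gamma>)) \<longlongrightarrow> - real n) (at_right 0)" for k :: real
    by real_asymp
  \<comment> \<open>For \<open>\<gamma> < 1\<close> the divisor \<open>ln (1 / \<gamma>)\<close> is
    positive, so dividing by it preserves inequalities.\<close>
  have small: "eventually (\<lambda>\<gamma>::real. 0 < \<gamma> \<and> \<gamma> < 1) (at_right 0)"
    using eventually_at_right_real[of 0 1] by simp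
  have ln_monom: "ln (k * \<gamma> ^ n) = ln k + real n * ln \<gamma>" if "0 < k" "0 < \<gamma>" for k \<gamma> :: real
    using that by (simp add: ln_mult ln_realpow)
  have "((\<lambda>\<gamma>. ln (P \<gamma>) / ln (1 / \<gamma>)) \<longlongrightarrow> - real n) (at_right 0)"
  proof (rule tendsto_sandwich[OF _ _ lim[of c] lim[of C]])
    show "eventually (\<lambda>\<gamma>. (ln c + real n * ln \<gamma>) / ln (1 / \<gamma>) \<le> ln (P \<gamma>) / ln (1 / \<gamma>)) (at_right 0)"
      using small lower
    proof eventually_elim
      case (elim \<gamma>)
      have "0 < c * \<gamma> ^ n"
        using assms elim by simp
      then have "ln (c * \<gamma> ^ n) \<le> ln (P \<gamma>)"
        using elim by simp
      then show ?case
        using elim assms by (intro divide_right_mono) (simp_all add: ln_monom)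
    qed
    show "eventually (\<lambda>\<gamma>. ln (P \<gamma>) / ln (1 / \<gamma>) \<le> (ln C + real n * ln \<gamma>) / ln (1 / \<gamma>)) (at_right 0)"
      using small lower upper
    proof eventually_elim
      case (elim \<gamma>)
      \<comment> \<open>The lower bound enters the upper estimate too: it makes
        \<open>P \<gamma>\<close> positive, as monotonicity of \<open>ln\<close> requires.\<close>
      have "0 < c * \<gamma> ^ n"
        using assms elim by simp
      then have "ln (P \<gamma>) \<le> ln (C * \<gamma> ^ n)"
        using elim by simp
      then show ?case
        using elim assms by (intro divide_right_mono) (simp_all add: ln_monom)
    qed
  qed
  then show ?thesis
    unfolding has_diversity_order_def by (intro exI[of _ "- real n"]) simp
qed

section \<open>Two-sided power bound for the outage probability\<close>

theorem proposition2:
  fixes M :: "'a measure"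
    and M\<^sub>R M\<^sub>T :: nat
    and \<rho>1 \<rho>2 :: real
    and z :: "nat \<times> nat \<Rightarrow> 'a \<Rightarrow> complex"
  assumes "prob_space M"
    and "M\<^sub>R \<ge> 1" and "M\<^sub>T \<ge> 1"
    and "\<bar>\<rho>1\<bar> < 1" and "\<bar>\<rho>2\<bar> < 1"
    and "prob_space.indep_vars M (\<lambda>_. borel) z ({1..M\<^sub>R} \<times> {1..M\<^sub>T})"
    and "\<And>p. p \<in> {1..M\<^sub>R} \<times> {1..M\<^sub>T} \<Longrightarrow> circ_sym_gaussian M 1 (z p)"
  shows "has_diversity_order
           (outage_prob M (fas_gain M\<^sub>R M\<^sub>T (dual_fas_channel \<rho>1 \<rho>2 z)))
           (real (M\<^sub>R * M\<^sub>T))"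
proof -
  interpret prob_space M
    by fact
  define I where "I = {1..M\<^sub>R} \<times> {1..M\<^sub>T}"
  define h where "h = dual_fas_channel \<rho>1 \<rho>2 z"
  have I: "finite I" "I \<noteq> {}" "(1, 1) \<in> I" "card I = M\<^sub>R * M\<^sub>T"
    using assms(2,3) by (auto simp: I_def)
  have indep: "indep_vars (\<lambda>_. borel) z I" and gauss: "\<And>p. p \<in> I \<Longrightarrow> circ_sym_gaussian M 1 (z p)"
    using assms(6,7) by (simp_all add: I_def)
  obtain a b :: "nat \<times> nat \<Rightarrow> real" where a: "\<And>p. 0 < a p" "\<And>p. a p \<le> 1" and b: "\<And>p. \<bar>b p\<bar> \<le> 1"
    and h: "\<And>p \<omega>. h p \<omega> = a p * z p \<omega> + b p * z (1, 1) \<omega>" and h0: "h (1, 1) = z (1, 1)"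
    using dual_fas_channel_decomp[OF assms(4,5)] unfolding h_def by metis
  have meas_z: "z p \<in> borel_measurable M" if "p \<in> I" for p
    using gauss[OF that] by (rule circ_sym_gaussian_borel_measurable)
  have meas_h: "h p \<in> borel_measurable M" if "p \<in> I" for p
  proof -
    have "(\<lambda>\<omega>. a p * z p \<omega> + b p * z (1, 1) \<omega>) \<in> borel_measurable M"
      using meas_z[OF that] meas_z[OF I(3)] by measurable
    then show ?thesis
      using h by presburger
  qed
  \<comment> \<open>Monotonicity of \<open>prob\<close> requires the larger event to be measurable.
    That event concerns \<open>h\<close> in the lower bound and \<open>z\<close>, with radii
    depending on the port, in the upper bound.\<close>
  have event: "{\<omega> \<in> space M. \<forall>p\<in>I. cmod (f p \<omega>) < s p} \<in> events"
    if "\<And>p. p \<in> I \<Longrightarrow> f p \<in> borel_measurable M" for f :: "nat \<times> nat \<Rightarrow> 'a \<Rightarrow> complex" and s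
  proof (rule sets.sets_Collect_finite_All[OF _ I(1)])
    fix p assume "p \<in> I"
    note [measurable] = that[OF this]
    show "{\<omega> \<in> space M. cmod (f p \<omega>) < s p} \<in> events"
      by measurable
  qed
  have outage: "outage_prob M (fas_gain M\<^sub>R M\<^sub>T h) \<gamma> = prob {\<omega> \<in> space M. \<forall>p\<in>I. cmod (h p \<omega>) < sqrt \<gamma>}"
    if "0 < \<gamma>" for \<gamma>
    unfolding outage_prob_def I_def fas_gain_power2_less_iff[OF assms(2,3) that] ..

  \<comment> \<open>The divisor 4 comes from the radius \<open>sqrt \<gamma> / 2\<close> in the
    lower disc estimate; the 16 is \<open>4 * 2\<^sup>2\<close>, from the bound
    \<open>4 * s\<^sup>2\<close> at radius \<open>2 * sqrt \<gamma> / a p\<close>.\<close>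
  define c where "c = (\<Prod>p\<in>I. (exp (- 1) / sqrt pi)\<^sup>2 / 4)"
  define C where "C = (\<Prod>p\<in>I. 16 / (a p)\<^sup>2)"
  have "0 < c" "0 < C"
    unfolding c_def C_def using a(1) by (auto intro!: prod_pos simp: less_imp_neq[symmetric])
  moreover have "eventually (\<lambda>\<gamma>. c * \<gamma> ^ card I \<le> outage_prob M (fas_gain M\<^sub>R M\<^sub>T h) \<gamma>) (at_right 0)"
  proof -
    \<comment> \<open>\<open>\<gamma> < 1\<close> keeps the radius \<open>sqrt \<gamma> / 2\<close>
      in the range of the lower disc estimate.\<close>
    have "eventually (\<lambda>\<gamma>::real. 0 < \<gamma> \<and> \<gamma> < 1) (at_right 0)"
      using eventually_at_right_real[of 0 1] by simp
    then show ?thesis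
    proof eventually_elim
      case (elim \<gamma>)
      have "c * \<gamma> ^ card I = (\<Prod>p\<in>I. (exp (- 1) / sqrt pi)\<^sup>2 / 4 * \<gamma>)"
        unfolding c_def prod.distrib by simp
      also have "\<dots> = (\<Prod>p\<in>I. (exp (- 1) / sqrt pi)\<^sup>2 * (sqrt \<gamma> / 2)\<^sup>2)"
        using elim by (intro prod.cong refl) (simp add: power_divide[of "sqrt \<gamma>"])
      also have "\<dots> \<le> (\<Prod>p\<in>I. prob {\<omega> \<in> space M. cmod (z p \<omega>) < sqrt \<gamma> / 2})"
      proof (intro prod_mono conjI circ_sym_gaussian_prob_disc_ge gauss)
        show "sqrt \<gamma> / 2 \<le> 1"
          using elim by (simp add: real_le_lsqrt)
      qed (use elim in auto)
      also have "\<dots> = prob {\<omega> \<in> space M. \<forall>p\<in>I. cmod (z p \<omega>) < sqrt \<gamma> / 2}"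
        by (rule indep_vars_prob_discs[OF indep I(1,2), symmetric])
      also have "\<dots> \<le> prob {\<omega> \<in> space M. \<forall>p\<in>I. cmod (h p \<omega>) < sqrt \<gamma>}"
      proof (intro finite_measure_mono event meas_h subsetI CollectI conjI ballI)
        fix \<omega> p
        assume \<omega>: "\<omega> \<in> {\<omega> \<in> space M. \<forall>p\<in>I. cmod (z p \<omega>) < sqrt \<gamma> / 2}" and p: "p \<in> I"
        have "cmod (h p \<omega>) \<le> a p * cmod (z p \<omega>) + \<bar>b p\<bar> * cmod (z (1, 1) \<omega>)"
          unfolding h using a(1)[of p] by (intro norm_triangle_le) (simp add: norm_mult)
        also have "\<dots> \<le> 1 * cmod (z p \<omega>) + 1 * cmod (z (1, 1) \<omega>)"
          using a(2)[of p] b[of p] by (intro add_mono mult_right_mono) auto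
        also have "\<dots> < sqrt \<gamma> / 2 + sqrt \<gamma> / 2"
          unfolding mult_1 using \<omega> p I(3) by (intro add_strict_mono) blast+
        finally show "cmod (h p \<omega>) < sqrt \<gamma>"
          by simp
      qed auto
      finally show ?case
        using outage elim by simp
    qed
  qed
  moreover have "eventually (\<lambda>\<gamma>. outage_prob M (fas_gain M\<^sub>R M\<^sub>T h) \<gamma> \<le> C * \<gamma> ^ card I) (at_right 0)"
  proof -
    have "eventually (\<lambda>\<gamma>::real. 0 < \<gamma>) (at_right 0)"
      by (rule eventually_at_right_less)
    then show ?thesis
    proof eventually_elim
      case (elim \<gamma>)
      have "outage_prob M (fas_gain M\<^sub>R M\<^sub>T h) \<gamma> = prob {\<omega> \<in> space M. \<forall>p\<in>I. cmod (h p \<omega>) < sqrt \<gamma>}"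
        using outage elim by simp
      also have "\<dots> \<le> prob {\<omega> \<in> space M. \<forall>p\<in>I. cmod (z p \<omega>) < 2 * sqrt \<gamma> / a p}"
      proof (intro finite_measure_mono event meas_z subsetI CollectI conjI ballI)
        fix \<omega> p
        assume \<omega>: "\<omega> \<in> {\<omega> \<in> space M. \<forall>p\<in>I. cmod (h p \<omega>) < sqrt \<gamma>}" and p: "p \<in> I"
        \<comment> \<open>The condition at port \<open>(1, 1)\<close> bounds the common term, which
          can then be subtracted from every \<open>h p\<close>.\<close>
        have z0: "cmod (z (1, 1) \<omega>) < sqrt \<gamma>"
          using \<omega> I(3) h0 by auto
        have "a p * cmod (z p \<omega>) = cmod (h p \<omega> - b p * z (1, 1) \<omega>)"
          unfolding h using a(1)[of p] by (simp add: norm_mult)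
        also have "\<dots> \<le> cmod (h p \<omega>) + \<bar>b p\<bar> * cmod (z (1, 1) \<omega>)"
          using norm_triangle_ineq4[of "h p \<omega>" "b p * z (1, 1) \<omega>"] by (simp add: norm_mult)
        also have "\<dots> \<le> cmod (h p \<omega>) + 1 * cmod (z (1, 1) \<omega>)"
          using b[of p] by (intro add_mono mult_right_mono) auto
        also have "\<dots> < 2 * sqrt \<gamma>"
          using \<omega> p z0 by fastforce
        finally show "cmod (z p \<omega>) < 2 * sqrt \<gamma> / a p"
          using a(1)[of p] by (simp add: less_divide_eq mult.commute)
      qed auto
      also have "\<dots> = (\<Prod>p\<in>I. prob {\<omega> \<in> space M. cmod (z p \<omega>) < 2 * sqrt \<gamma> / a p})"
        by (rule indep_vars_prob_discs[OF indep I(1,2)])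
      also have "\<dots> \<le> (\<Prod>p\<in>I. 4 * (2 * sqrt \<gamma> / a p)\<^sup>2)"
        using elim a(1) by (intro prod_mono conjI circ_sym_gaussian_prob_disc_le gauss)
          (auto simp: less_imp_le)
      also have "\<dots> = (\<Prod>p\<in>I. 16 / (a p)\<^sup>2 * \<gamma>)"
        using elim by (intro prod.cong) (auto simp: power_divide power_mult_distrib)
      also have "\<dots> = C * \<gamma> ^ card I"
        unfolding C_def prod.distrib by simp
      finally show ?case .
    qed
  qed
  ultimately show ?thesis
    unfolding I(4)[symmetric] h_def[symmetric] by (rule has_diversity_orderI)
qed

end
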